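(* Let $\mathcal P$ be a finite poset with $p$ elements, and let $n\geq 3p-1$ be a positive integer. Then $\text{sat}_p(n,\mathcal P)=p+1$ if $\mathcal P$ has neither a unique maximal nor a unique minimal element; $\text{sat}_p(n,\mathcal P)=p-1$ if $\mathcal P$ has both a unique maximal and a unique minimal element; and $\text{sat}_p(n,\mathcal P)=p$ otherwise.
   Context: A poset $\mathcal Q$ contains an induced copy of a poset $\mathcal P$ if there is an injective map $f:\mathcal P\to\mathcal Q$ with $f(x)\le f(y)$ iff $x\le y$. A family $\mathcal F$ of subsets of $[n]$ (ordered by inclusion) is $\mathcal P$-percolating if there is an ordering $A_1,\dots,A_N$ of all subsets of $[n]$ not in $\mathcal F$ such that for every $i\in[N]$, the family $\mathcal F\cup\{A_1,\dots,A_i\}$ contains an induced copy of $\mathcal P$ having $A_i$ as one of its elements. The percolation number $\text{sat}_p(n,\mathcal P)$ is the minimum size of a $\mathcal P$-percolating family of subsets of $[n]$. *)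

theory Defs
  imports Main
begin

text \<open>
  A poset is a carrier \<open>P\<close> with a relation \<open>r\<close> such that \<open>partial_order_on P r\<close>; a pair
  \<open>(x, y) \<in> r\<close> means \<open>x \<le> y\<close>.  The target of a copy is a subset \<open>Q\<close> of a type of class
  \<^class>\<open>order\<close>, ordered by \<open>\<le>\<close>; for families of sets this is inclusion.
\<close>

definition induced_copy :: "'a set \<Rightarrow> 'a rel \<Rightarrow> 'b::order set \<Rightarrow> ('a \<Rightarrow> 'b) \<Rightarrow> bool" where
  "induced_copy P r Q f \<longleftrightarrow>
     f ` P \<subseteq> Q \<and> inj_on f P \<and> (\<forall>x\<in>P. \<forall>y\<in>P. f x \<le> f y \<longleftrightarrow> (x, y) \<in> r)"

definition percolating :: "nat \<Rightarrow> 'a set \<Rightarrow> 'a rel \<Rightarrow> nat set set \<Rightarrow> bool" where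
  "percolating n P r F \<longleftrightarrow>
     F \<subseteq> Pow {1..n} \<and>
     (\<exists>As. distinct As \<and> set As = Pow {1..n} - F \<and>
       (\<forall>i<length As. \<exists>f. induced_copy P r (F \<union> set (take (Suc i) As)) f \<and> As ! i \<in> f ` P))"

text \<open>
  The full family \<open>Pow {1..n}\<close> is percolating, so the minimum
  below is always attained.
\<close>

definition sat_p :: "nat \<Rightarrow> 'a set \<Rightarrow> 'a rel \<Rightarrow> nat" where
  "sat_p n P r = (LEAST k. \<exists>F. percolating n P r F \<and> card F = k)"

definition maximal_in :: "'a set \<Rightarrow> 'a rel \<Rightarrow> 'a \<Rightarrow> bool" where
  "maximal_in P r x \<longleftrightarrow> x \<in> P \<and> (\<forall>y\<in>P. (x, y) \<in> r \<longrightarrow> y = x)"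

definition minimal_in :: "'a set \<Rightarrow> 'a rel \<Rightarrow> 'a \<Rightarrow> bool" where
  "minimal_in P r x \<longleftrightarrow> x \<in> P \<and> (\<forall>y\<in>P. (y, x) \<in> r \<longrightarrow> y = x)"

end

theory Submission
  imports Defs
begin

text \<open>
  Lower bound: the first added set needs \<open>p - 1\<close> members of the family, and \<open>\<emptyset>\<close> (dually \<open>[n]\<close>)
  lies in no copy of \<open>P\<close>, hence in the family, unless \<open>P\<close> has a least (greatest) element.

  Upper bound: embed \<open>P\<close> into \<open>[n]\<close>, take the principal down-sets of all elements but one maximal
  \<open>x\<close>, and add \<open>\<emptyset>\<close> and \<open>[n]\<close> where forced. Let \<open>W\<close> be the complement of the image of \<open>P - {x}\<close>, so
  \<open>|W| \<ge> 2p\<close>, and let \<open>D\<close> be the image of the strict down-set of \<open>x\<close>. All \<open>D \<union> S\<close> with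
  \<open>\<emptyset> \<noteq> S \<subseteq> W\<close> can play the role of \<open>x\<close>. Next, a set \<open>A \<supseteq> D\<close> with \<open>|A \<inter> W| \<ge> p\<close> and \<open>W \<not>\<subseteq> A\<close> can play
  a maximal element, the others being of the form \<open>D \<union> S\<close>. Dually, any \<open>A\<close> with \<open>|W - A| \<ge> p\<close> that
  meets \<open>W\<close> can play a minimal element, and one more upward step reaches every \<open>A\<close> with
  \<open>A \<inter> W \<notin> {\<emptyset>, W}\<close>. These sets suffice to complete a copy around each remaining \<open>A\<close>.
\<close>

section \<open>Families closed under completing copies of \<open>P\<close>\<close>

text \<open>The closed families of the percolation process: no set outside \<open>C\<close> can be
  added next. They allow sets to be shown reachable without keeping track of an ordering.\<close>

definition absorbing :: "'b set \<Rightarrow> 'a set \<Rightarrow> 'a rel \<Rightarrow> 'b set set \<Rightarrow> bool" where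
  "absorbing U P r C \<longleftrightarrow>
     C \<subseteq> Pow U \<and> (\<forall>A f. A \<subseteq> U \<and> induced_copy P r (insert A C) f \<and> A \<in> f ` P \<longrightarrow> A \<in> C)"

text \<open>Working form: \<open>A\<close> plays \<open>z\<close> and \<open>f\<close> places the
  rest of \<open>P\<close>. Checking comparisons is enough, because reflecting the order into an
  antisymmetric relation already gives injectivity.\<close>

lemma absorbingD:
  assumes "absorbing U P r C" "partial_order_on P r" "z \<in> P" "A \<subseteq> U"
    and in_C: "\<And>y. y \<in> P - {z} \<Longrightarrow> f y \<in> C"
    and iff: "\<And>y y'. y \<in> P - {z} \<Longrightarrow> y' \<in> P - {z} \<Longrightarrow> f y \<subseteq> f y' \<longleftrightarrow> (y, y') \<in> r"
    and below: "\<And>y. y \<in> P - {z} \<Longrightarrow> f y \<subseteq> A \<longleftrightarrow> (y, z) \<in> r"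
    and above: "\<And>y. y \<in> P - {z} \<Longrightarrow> A \<subseteq> f y \<longleftrightarrow> (z, y) \<in> r"
  shows "A \<in> C"
proof -
  define g where "g = f(z := A)"
  have order: "g x \<subseteq> g y \<longleftrightarrow> (x, y) \<in> r" if "x \<in> P" "y \<in> P" for x y
    using that iff below above assms(2)
    by (cases "x = z"; cases "y = z") (auto simp: g_def partial_order_on_def preorder_on_def dest: refl_onD)
  moreover have "inj_on g P"
  proof (rule inj_onI)
    fix x y assume "x \<in> P" "y \<in> P" "g x = g y"
    then have "(x, y) \<in> r" "(y, x) \<in> r" using order[of x y] order[of y x] by auto
    then show "x = y" using assms(2) by (auto simp: partial_order_on_def dest: antisymD)
  qed
  ultimately have "induced_copy P r (insert A C) g"
    using in_C unfolding induced_copy_def by (auto simp: g_def)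
  moreover have "A \<in> g ` P" using \<open>z \<in> P\<close> by (auto simp: g_def)
  ultimately show ?thesis using assms(1,4) unfolding absorbing_def by blast
qed

section \<open>Duality by complementation\<close>

text \<open>Complementing inside \<open>U\<close> reverses inclusion, so it turns copies of
  \<open>P\<close> into copies of the dual poset. Each downward argument can thus be obtained from
  its upward version.\<close>

lemma absorbing_complement:
  assumes "absorbing U P r C"
  shows "absorbing U P (r\<inverse>) ((-) U ` C)"
  unfolding absorbing_def
proof (intro conjI allI impI)
  show "(-) U ` C \<subseteq> Pow U" by auto
next
  fix A f assume *: "A \<subseteq> U \<and> induced_copy P (r\<inverse>) (insert A ((-) U ` C)) f \<and> A \<in> f ` P"
  have CU: "C \<subseteq> Pow U" using assms by (auto simp: absorbing_def)
  have fU: "f y \<subseteq> U" if "y \<in> P" for y using * that by (auto simp: induced_copy_def)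
  define g where "g = (\<lambda>y. U - f y)"
  have "g y \<in> insert (U - A) C" if "y \<in> P" for y
  proof -
    have "f y \<in> insert A ((-) U ` C)" using * that by (auto simp: induced_copy_def)
    then show ?thesis using CU by (auto simp: g_def double_diff)
  qed
  moreover have order: "g x \<subseteq> g y \<longleftrightarrow> (x, y) \<in> r" if "x \<in> P" "y \<in> P" for x y
  proof -
    have "g x \<subseteq> g y \<longleftrightarrow> f y \<subseteq> f x" using fU[of x] fU[of y] that by (auto simp: g_def)
    then show ?thesis using * that by (auto simp: induced_copy_def)
  qed
  moreover have "inj_on g P"
  proof (rule inj_onI)
    fix x y assume xy: "x \<in> P" "y \<in> P" "g x = g y"
    then have "f x = f y" using fU[of x] fU[of y] by (auto simp: g_def)
    then show "x = y" using * xy by (auto simp: induced_copy_def inj_on_def)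
  qed
  ultimately have "induced_copy P r (insert (U - A) C) g" unfolding induced_copy_def by auto
  moreover have "U - A \<in> g ` P" using * by (auto simp: g_def)
  ultimately have "U - A \<in> C" using assms unfolding absorbing_def by blast
  then show "A \<in> (-) U ` C" using * by (auto simp: double_diff intro!: image_eqI[where x = "U - A"])
qed

lemma mem_complement_image_iff:
  assumes "C \<subseteq> Pow U" "A \<subseteq> U"
  shows "A \<in> (-) U ` C \<longleftrightarrow> U - A \<in> C"
proof
  assume "A \<in> (-) U ` C"
  then show "U - A \<in> C" using assms by (auto simp: double_diff)
next
  assume "U - A \<in> C"
  then show "A \<in> (-) U ` C" using assms by (auto simp: double_diff intro!: image_eqI[where x = "U - A"])
qed

section \<open>Minimal and least elements of a finite poset\<close>

lemma minimal_in_converse: "minimal_in P (r\<inverse>) = maximal_in P r"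
  by (auto simp: maximal_in_def minimal_in_def fun_eq_iff)

lemma ex_minimal_below:
  assumes "partial_order_on P r" "finite P" "y \<in> P"
  obtains m where "minimal_in P r m" "(m, y) \<in> r"
proof -
  have "y \<in> P \<longrightarrow> (\<exists>m. minimal_in P r m \<and> (m, y) \<in> r)"
  proof (induction "card {u \<in> P. (u, y) \<in> r}" arbitrary: y rule: less_induct)
    case less
    show ?case
    proof (rule impI, cases "minimal_in P r y")
      case True
      assume "y \<in> P"
      then have "(y, y) \<in> r" using assms(1) by (auto simp: partial_order_on_def preorder_on_def dest: refl_onD)
      with True show "\<exists>m. minimal_in P r m \<and> (m, y) \<in> r" by blast
    next
      case False
      assume "y \<in> P"
      then obtain u where u: "u \<in> P" "(u, y) \<in> r" "u \<noteq> y" using False by (auto simp: minimal_in_def)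
      have tr: "trans r" and "antisym r" and "(y, y) \<in> r"
        using assms(1) \<open>y \<in> P\<close> by (auto simp: partial_order_on_def preorder_on_def dest: refl_onD)
      then have "{v \<in> P. (v, u) \<in> r} \<subset> {v \<in> P. (v, y) \<in> r}"
        using u \<open>y \<in> P\<close> by (auto dest: transD antisymD)
      then have "card {v \<in> P. (v, u) \<in> r} < card {v \<in> P. (v, y) \<in> r}"
        using assms(2) by (intro psubset_card_mono) auto
      with less u obtain m where "minimal_in P r m" "(m, u) \<in> r" by blast
      with u tr show "\<exists>m. minimal_in P r m \<and> (m, y) \<in> r" by (blast dest: transD)
    qed
  qed
  with assms that show ?thesis by blast
qed

text \<open>In a finite poset every element lies above a minimal one; if there is only one minimal
  element, it lies below everything.\<close>

lemma unique_minimal_iff_least: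
  assumes "partial_order_on P r" "finite P"
  shows "(\<exists>!x. minimal_in P r x) \<longleftrightarrow> (\<exists>x\<in>P. \<forall>y\<in>P. (x, y) \<in> r)"
proof
  assume "\<exists>!x. minimal_in P r x"
  then obtain x where x: "minimal_in P r x" "\<And>m. minimal_in P r m \<Longrightarrow> m = x" by blast
  have "(x, y) \<in> r" if y: "y \<in> P" for y
  proof -
    obtain m where "minimal_in P r m" "(m, y) \<in> r" using ex_minimal_below[OF assms y] .
    then show ?thesis using x(2)[of m] by simp
  qed
  moreover have "x \<in> P" using x(1) by (simp add: minimal_in_def)
  ultimately show "\<exists>x\<in>P. \<forall>y\<in>P. (x, y) \<in> r" by blast
next
  assume "\<exists>x\<in>P. \<forall>y\<in>P. (x, y) \<in> r"
  then obtain x where x: "x \<in> P" "\<And>y. y \<in> P \<Longrightarrow> (x, y) \<in> r" by blast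
  show "\<exists>!x. minimal_in P r x"
  proof (rule ex1I)
    have "antisym r" using assms(1) by (simp add: partial_order_on_def)
    then show "minimal_in P r x"
      using x unfolding minimal_in_def by (blast dest: antisymD)
    show "m = x" if "minimal_in P r m" for m
      using that x(1) x(2)[of m] unfolding minimal_in_def by blast
  qed
qed

lemma unique_maximal_iff_greatest:
  assumes "partial_order_on P r" "finite P"
  shows "(\<exists>!x. maximal_in P r x) \<longleftrightarrow> (\<exists>x\<in>P. \<forall>y\<in>P. (y, x) \<in> r)"
  using unique_minimal_iff_least[of P "r\<inverse>"] assms by (simp add: minimal_in_converse)

lemma ex_inj_into:
  assumes "finite P" "finite T" "card P \<le> card T"
  obtains g where "g ` P \<subseteq> T" "inj_on g P"
  using assms card_le_inj[of P T] by blast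

section \<open>Spreading from seeds to other sets\<close>

text \<open>\<open>A\<close> plays a maximal \<open>z\<close>. Labels \<open>g u\<close> drawn from
  \<open>A \<inter> W\<close> encode the rest of \<open>P\<close> by down-sets, and a point
  \<open>w\<close> of \<open>W\<close> outside \<open>A\<close> marks the elements not below
  \<open>z\<close>.\<close>

lemma absorbing_above:
  assumes C: "absorbing U P r C" and po: "partial_order_on P r" and fin: "finite P" and "P \<noteq> {}"
    and W: "W \<subseteq> U" "finite W" "card W \<ge> 2 * card P" and D: "D \<inter> W = {}"
    and seed: "\<And>S. S \<subseteq> W \<Longrightarrow> S \<noteq> {} \<Longrightarrow> card P \<le> card (W - S) \<Longrightarrow> D \<union> S \<in> C"
    and A: "A \<subseteq> U" "D \<subseteq> A" "card P \<le> card (A \<inter> W)" "\<not> W \<subseteq> A"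
  shows "A \<in> C"
proof -
  obtain z where z: "maximal_in P r z"
    using ex_minimal_below[of P "r\<inverse>"] po fin \<open>P \<noteq> {}\<close> by (auto simp: minimal_in_converse)
  obtain w where w: "w \<in> W" "w \<notin> A" using A by blast
  have zP: "z \<in> P" using z by (simp add: maximal_in_def)
  obtain g where g: "g ` P \<subseteq> A \<inter> W" "inj_on g P"
    using ex_inj_into[OF fin _ A(3)] W(2) by auto
  have tr: "trans r" and rf: "\<And>y. y \<in> P \<Longrightarrow> (y, y) \<in> r"
    using po by (auto simp: partial_order_on_def preorder_on_def dest: refl_onD)
  define dn where "dn y = {u \<in> P. (u, y) \<in> r}" for y
  \<comment> \<open>\<open>g z \<in> A\<close> lies in no \<open>S y\<close>, and \<open>w \<notin> A\<close> lies in \<open>S y\<close> exactly when \<open>y\<close> is not below \<open>z\<close>.\<close>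
  define S where "S y = g ` dn y \<union> (if (y, z) \<in> r then {} else {w})" for y
  have dn: "dn y \<subseteq> P - {z}" "y \<in> dn y" if "y \<in> P - {z}" for y
    using that z rf by (auto simp: dn_def maximal_in_def)
  have gz: "g z \<in> A" "g z \<in> W" using g zP by auto
  have gA: "g u \<in> A" "g u \<in> W" if "u \<in> P" for u using g that by auto
  have SW: "S y \<subseteq> W" if "y \<in> P - {z}" for y
    using dn[OF that] gA w by (auto simp: S_def)
  have g_mem: "g u \<in> g ` dn y \<longleftrightarrow> (u, y) \<in> r" if "u \<in> P" for u y
    using that g(2) by (auto simp: dn_def inj_on_def)
  have gS: "g u \<in> S y \<longleftrightarrow> (u, y) \<in> r" if "u \<in> P" "y \<in> P - {z}" for u y
    using g_mem[OF that(1), of y] gA[OF that(1)] w by (auto simp: S_def)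
  show ?thesis
  proof (rule absorbingD[OF C po zP A(1), where f = "\<lambda>y. D \<union> S y"])
    fix y assume y: "y \<in> P - {z}"
    \<comment> \<open>At most \<open>card P - 1\<close> labels, as \<open>z\<close> is not below
      \<open>y\<close>, plus possibly \<open>w\<close>. With \<open>card W \<ge> 2 * card P\<close>
      this leaves the \<open>card P\<close> points of \<open>W\<close> outside \<open>S y\<close>
      that \<open>seed\<close> asks for.\<close>
    have "card (S y) \<le> card P"
    proof -
      have "card (g ` dn y) \<le> card (P - {z})"
        using dn(1)[OF y] fin by (meson card_image_le card_mono finite_Diff finite_subset order_trans)
      moreover have "card (S y) \<le> card (g ` dn y) + 1"
        using card_Un_le[of "g ` dn y" "{w}"] by (auto simp: S_def)
      moreover have "card (P - {z}) = card P - 1" "card P > 0"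
        using zP fin by (auto simp: card_gt_0_iff)
      ultimately show ?thesis by linarith
    qed
    moreover have "card (W - S y) = card W - card (S y)"
      using SW[OF y] W(2) by (meson card_Diff_subset finite_subset)
    moreover have "S y \<noteq> {}" using gS[of y y] y rf by auto
    ultimately show "D \<union> S y \<in> C" using seed[OF SW[OF y]] W(3) by linarith
    have "w \<in> S y \<longleftrightarrow> (y, z) \<notin> r" using dn(1)[OF y] gA w by (auto simp: S_def)
    moreover have "S y \<subseteq> insert w A" using dn(1)[OF y] gA by (auto simp: S_def)
    ultimately show "D \<union> S y \<subseteq> A \<longleftrightarrow> (y, z) \<in> r" using A(2) w by blast
    have "(z, y) \<notin> r" using y z by (auto simp: maximal_in_def)
    then have "g z \<notin> D \<union> S y" using gS[OF zP y] D gz by auto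
    with \<open>(z, y) \<notin> r\<close> gz show "A \<subseteq> D \<union> S y \<longleftrightarrow> (z, y) \<in> r" by auto
  next
    fix y y' assume y: "y \<in> P - {z}" and y': "y' \<in> P - {z}"
    show "D \<union> S y \<subseteq> D \<union> S y' \<longleftrightarrow> (y, y') \<in> r"
    proof
      assume "D \<union> S y \<subseteq> D \<union> S y'"
      moreover have "g y \<in> S y" using gS[of y y] y rf by auto
      moreover have "g y \<notin> D" using gA y D by auto
      ultimately show "(y, y') \<in> r" using gS[of y y'] y y' by auto
    next
      assume r: "(y, y') \<in> r"
      then have "dn y \<subseteq> dn y'" using tr by (auto simp: dn_def dest: transD)
      moreover have "(y', z) \<in> r \<Longrightarrow> (y, z) \<in> r" using r tr by (blast dest: transD)
      ultimately show "D \<union> S y \<subseteq> D \<union> S y'" by (auto simp: S_def)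
    qed
  qed
qed

text \<open>This is \<open>absorbing_above\<close> with \<open>D = {}\<close>, applied to the
  complements and the dual order: \<open>A\<close> meeting \<open>W\<close> becomes \<open>W\<close>
  not contained in \<open>U - A\<close>.\<close>

lemma absorbing_below:
  assumes C: "absorbing U P r C" and po: "partial_order_on P r" and fin: "finite P" and "P \<noteq> {}"
    and W: "W \<subseteq> U" "finite W" "card W \<ge> 2 * card P"
    and seed: "\<And>S. S \<subseteq> W \<Longrightarrow> S \<noteq> {} \<Longrightarrow> card P \<le> card (W - S) \<Longrightarrow> U - S \<in> C"
    and A: "A \<subseteq> U" "card P \<le> card (W - A)" "A \<inter> W \<noteq> {}"
  shows "A \<in> C"
proof -
  have CU: "C \<subseteq> Pow U" using C by (simp add: absorbing_def)
  have "U - A \<in> (-) U ` C"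
  proof (rule absorbing_above[where D = "{}", OF absorbing_complement[OF C] _ fin \<open>P \<noteq> {}\<close> W])
    show "partial_order_on P (r\<inverse>)" using po by simp
    show "{} \<union> S \<in> (-) U ` C" if "S \<subseteq> W" "S \<noteq> {}" "card P \<le> card (W - S)" for S
      using seed[OF that] mem_complement_image_iff[OF CU, of S] that W by auto
    have "(U - A) \<inter> W = W - A" using W by auto
    then show "card P \<le> card ((U - A) \<inter> W)" using A by simp
  qed (use A W in auto)
  then show ?thesis using mem_complement_image_iff[OF CU, of "U - A"] A by (auto simp: double_diff)
qed

text \<open>\<open>A\<close> plays a minimal \<open>z\<close>, with all other elements placed among
  the sets covered by \<open>mid\<close>. The empty set lies below every set, so it can only play a
  least element; hence the condition \<open>least\<close>.\<close>

lemma absorbing_bottom: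
  assumes C: "absorbing U P r C" and po: "partial_order_on P r" and fin: "finite P"
    and W: "W \<subseteq> U" "finite W" "card W \<ge> card P"
    and mid: "\<And>B. B \<subseteq> U \<Longrightarrow> B \<inter> W \<noteq> {} \<Longrightarrow> \<not> W \<subseteq> B \<Longrightarrow> B \<in> C"
    and A: "A \<subseteq> U" "A \<inter> W = {}" and z: "minimal_in P r z"
    and least: "A = {} \<Longrightarrow> \<forall>y\<in>P. (z, y) \<in> r"
  shows "A \<in> C"
proof -
  have zP: "z \<in> P" using z by (simp add: minimal_in_def)
  obtain g where g: "g ` P \<subseteq> W" "inj_on g P"
    using ex_inj_into[OF fin _ W(3)] W(2) by auto
  have tr: "trans r" and rf: "\<And>y. y \<in> P \<Longrightarrow> (y, y) \<in> r"
    using po by (auto simp: partial_order_on_def preorder_on_def dest: refl_onD)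
  \<comment> \<open>\<open>A\<close> stands in for the label of \<open>z\<close>. As
    \<open>g z\<close> is left out and \<open>g y\<close> is kept, each \<open>S y\<close> with
    \<open>y \<noteq> z\<close> meets \<open>W\<close> without containing it, so \<open>mid\<close>
    applies.\<close>
  define S where "S y = g ` {u \<in> P - {z}. (u, y) \<in> r} \<union> (if (z, y) \<in> r then A else {})" for y
  have gW: "g u \<in> W" "g u \<notin> A" if "u \<in> P" for u using g that A by auto
  have gS: "g u \<in> S y \<longleftrightarrow> u \<noteq> z \<and> (u, y) \<in> r" if "u \<in> P" for u y
    using that g(2) gW[OF that] by (auto simp: S_def inj_on_def)
  show ?thesis
  proof (rule absorbingD[OF C po zP A(1), where f = S])
    fix y assume y: "y \<in> P - {z}"
    have "S y \<subseteq> U" using g A W by (auto simp: S_def)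
    moreover have gy: "g y \<in> S y" "g y \<in> W" "g y \<notin> A" using gS[of y y] y rf gW by auto
    moreover have "g z \<notin> S y" "g z \<in> W" using gS[of z y] zP gW by auto
    ultimately show "S y \<in> C" using mid[of "S y"] by blast
    have "(y, z) \<notin> r" using y z by (auto simp: minimal_in_def)
    then show "S y \<subseteq> A \<longleftrightarrow> (y, z) \<in> r" using gy by auto
    show "A \<subseteq> S y \<longleftrightarrow> (z, y) \<in> r"
    proof (cases "A = {}")
      case True then show ?thesis using least y by auto
    next
      case False
      then show ?thesis using gW by (auto simp: S_def)
    qed
  next
    fix y y' assume y: "y \<in> P - {z}" and y': "y' \<in> P - {z}"
    show "S y \<subseteq> S y' \<longleftrightarrow> (y, y') \<in> r"
    proof
      assume "S y \<subseteq> S y'"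
      then show "(y, y') \<in> r" using gS[of y y] gS[of y y'] y y' rf by auto
    next
      assume r: "(y, y') \<in> r"
      then have "(u, y) \<in> r \<Longrightarrow> (u, y') \<in> r" for u using tr by (blast dest: transD)
      then show "S y \<subseteq> S y'" by (auto simp: S_def)
    qed
  qed
qed

text \<open>Dual of \<open>absorbing_bottom\<close>; the condition in \<open>mid\<close> is
  invariant under complementation, and \<open>A = U\<close> takes the place of the empty
  set.\<close>

lemma absorbing_top:
  assumes C: "absorbing U P r C" and po: "partial_order_on P r" and fin: "finite P"
    and W: "W \<subseteq> U" "finite W" "card W \<ge> card P"
    and mid: "\<And>B. B \<subseteq> U \<Longrightarrow> B \<inter> W \<noteq> {} \<Longrightarrow> \<not> W \<subseteq> B \<Longrightarrow> B \<in> C"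
    and A: "A \<subseteq> U" "W \<subseteq> A" and z: "maximal_in P r z"
    and greatest: "A = U \<Longrightarrow> \<forall>y\<in>P. (y, z) \<in> r"
  shows "A \<in> C"
proof -
  have CU: "C \<subseteq> Pow U" using C by (simp add: absorbing_def)
  have "U - A \<in> (-) U ` C"
  proof (rule absorbing_bottom[OF absorbing_complement[OF C] _ fin W])
    show "partial_order_on P (r\<inverse>)" using po by simp
    show "B \<in> (-) U ` C" if "B \<subseteq> U" "B \<inter> W \<noteq> {}" "\<not> W \<subseteq> B" for B
    proof -
      have "(U - B) \<inter> W \<noteq> {}" "\<not> W \<subseteq> U - B" using that W by auto
      then show ?thesis using mid[of "U - B"] mem_complement_image_iff[OF CU that(1)] by auto
    qed
    show "minimal_in P (r\<inverse>) z" using z by (simp add: minimal_in_converse)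
    show "\<forall>y\<in>P. (z, y) \<in> r\<inverse>" if "U - A = {}" using that greatest A by auto
  qed (use A in auto)
  then show ?thesis using mem_complement_image_iff[OF CU, of "U - A"] A by (auto simp: double_diff)
qed

section \<open>The seed family generates the whole power set\<close>

text \<open>The image is the standard embedding of a poset by principal down-sets, relabelled by
  \<open>h\<close>, with the set of \<open>x\<close> missing.\<close>

definition seed_family :: "'b set \<Rightarrow> 'a set \<Rightarrow> 'a rel \<Rightarrow> ('a \<Rightarrow> 'b) \<Rightarrow> 'a \<Rightarrow> 'b set set" where
  "seed_family U P r h x =
     (\<lambda>y. h ` {u \<in> P. (u, y) \<in> r}) ` (P - {x})
     \<union> (if \<exists>!x. minimal_in P r x then {} else {{}})
     \<union> (if \<exists>!x. maximal_in P r x then {} else {U})"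

text \<open>Each stage feeds the next: \<open>seed\<close>, \<open>up\<close>, \<open>down\<close>,
  \<open>up'\<close>, \<open>mid\<close>, and finally the sets that avoid or contain
  \<open>W\<close>.\<close>

lemma absorbing_seed_family_eq_Pow:
  assumes C: "absorbing U P r C" and po: "partial_order_on P r" and fin: "finite P"
    and U: "finite U" "card U + 1 \<ge> 3 * card P" and h: "h ` P \<subseteq> U" "inj_on h P"
    and x: "maximal_in P r x" and sub: "seed_family U P r h x \<subseteq> C"
  shows "C = Pow U"
proof -
  have xP: "x \<in> P" using x by (simp add: maximal_in_def)
  then have ne: "P \<noteq> {}" by auto
  define W where "W = U - h ` (P - {x})"
  define D where "D = h ` {u \<in> P - {x}. (u, x) \<in> r}"
  have hP: "h ` (P - {x}) \<subseteq> U" using h by auto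
  have "card (h ` (P - {x})) = card P - 1"
    using h(2) xP fin by (simp add: card_image inj_on_diff)
  then have "card W = card U - (card P - 1)"
    unfolding W_def using hP fin by (simp add: card_Diff_subset)
  moreover have "card P > 0" using ne fin by (simp add: card_gt_0_iff)
  \<comment> \<open>The bound on \<open>card U\<close> enters here: (3p - 1) - (p - 1) = 2p.\<close>
  ultimately have cW: "card W \<ge> 2 * card P" using U(2) by linarith
  have WU: "W \<subseteq> U" and fW: "finite W" using U by (auto simp: W_def)
  have DW: "D \<inter> W = {}" and DU: "D \<subseteq> U" using hP by (auto simp: D_def W_def)
  have tr: "trans r" and as: "antisym r" and rf: "\<And>y. y \<in> P \<Longrightarrow> (y, y) \<in> r"
    using po by (auto simp: partial_order_on_def preorder_on_def dest: refl_onD)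
  \<comment> \<open>\<open>D \<union> S\<close> plays \<open>x\<close>. The other down-sets avoid
    \<open>W\<close>, so a nonempty \<open>S\<close> keeps \<open>D \<union> S\<close> out of all of
    them, and \<open>S\<close> does not affect which of them lie below it.\<close>
  have seed: "D \<union> S \<in> C" if S: "S \<subseteq> W" "S \<noteq> {}" for S
  proof (rule absorbingD[OF C po xP, where f = "\<lambda>y. h ` {u \<in> P. (u, y) \<in> r}"])
    show "D \<union> S \<subseteq> U" using DU WU S by auto
  next
    fix y assume y: "y \<in> P - {x}"
    let ?f = "h ` {u \<in> P. (u, y) \<in> r}"
    show "?f \<in> C" using sub y by (auto simp: seed_family_def)
    have xy: "(x, y) \<notin> r" using y x by (auto simp: maximal_in_def)
    then have "?f \<subseteq> h ` (P - {x})" by auto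
    then have disj: "?f \<inter> S = {}" using S by (auto simp: W_def)
    then show "D \<union> S \<subseteq> ?f \<longleftrightarrow> (x, y) \<in> r" using S xy by auto
    show "?f \<subseteq> D \<union> S \<longleftrightarrow> (y, x) \<in> r"
    proof
      assume "?f \<subseteq> D \<union> S"
      moreover have "h y \<in> ?f" using y rf by auto
      ultimately have "h y \<in> D" using disj by auto
      then show "(y, x) \<in> r" using y h(2) by (auto simp: D_def inj_on_def)
    next
      assume "(y, x) \<in> r"
      then have "?f \<subseteq> D" using tr xy by (auto simp: D_def dest: transD)
      then show "?f \<subseteq> D \<union> S" by auto
    qed
  next
    fix y y' assume y: "y \<in> P - {x}" "y' \<in> P - {x}"
    show "h ` {u \<in> P. (u, y) \<in> r} \<subseteq> h ` {u \<in> P. (u, y') \<in> r} \<longleftrightarrow> (y, y') \<in> r"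
    proof
      assume "h ` {u \<in> P. (u, y) \<in> r} \<subseteq> h ` {u \<in> P. (u, y') \<in> r}"
      then have "h y \<in> h ` {u \<in> P. (u, y') \<in> r}" using y rf by blast
      then show "(y, y') \<in> r" using y h(2) by (auto simp: inj_on_def)
    qed (use tr in \<open>auto dest: transD\<close>)
  qed
  have up: "B \<in> C" if "B \<subseteq> U" "D \<subseteq> B" "card P \<le> card (B \<inter> W)" "\<not> W \<subseteq> B" for B
    by (rule absorbing_above[OF C po fin ne WU fW cW DW _ that]) (use seed in auto)
  have down: "B \<in> C" if "B \<subseteq> U" "card P \<le> card (W - B)" "B \<inter> W \<noteq> {}" for B
  proof (rule absorbing_below[OF C po fin ne WU fW cW _ that])
    \<comment> \<open>\<open>U - S\<close> contains \<open>D\<close>, has at least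
      \<open>card P\<close> points of \<open>W\<close> and misses a point of \<open>W\<close>, so it
      is an instance of \<open>up\<close>.\<close>
    fix S assume S: "S \<subseteq> W" "S \<noteq> {}" "card P \<le> card (W - S)"
    have "(U - S) \<inter> W = W - S" using WU by auto
    then show "U - S \<in> C" using S WU DU DW by (intro up) auto
  qed
  \<comment> \<open>By \<open>down\<close>, the sets \<open>S\<close> themselves now serve as seeds.
    Rerunning the upward step with \<open>D = {}\<close> removes the restriction
    \<open>D \<subseteq> B\<close>.\<close>
  have up': "B \<in> C" if "B \<subseteq> U" "card P \<le> card (B \<inter> W)" "\<not> W \<subseteq> B" for B
    by (rule absorbing_above[OF C po fin ne WU fW cW, where D = "{}"])
      (use that down WU in \<open>auto simp: Int_absorb2\<close>)
  \<comment> \<open>Since \<open>W\<close> has at least \<open>2 * card P\<close> points, one of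
    \<open>W - B\<close> and \<open>B \<inter> W\<close> has at least \<open>card P\<close>.\<close>
  have mid: "B \<in> C" if "B \<subseteq> U" "B \<inter> W \<noteq> {}" "\<not> W \<subseteq> B" for B
  proof -
    have "card W = card (W - B) + card (B \<inter> W)"
      using card_Int_Diff[OF fW, of B] by (simp add: Int_commute)
    then have "card P \<le> card (W - B) \<or> card P \<le> card (B \<inter> W)" using cW by linarith
    then show ?thesis using up' down that by blast
  qed
  have cW': "card P \<le> card W" using cW by linarith
  have "A \<in> C" if A: "A \<subseteq> U" for A
  proof -
    consider "A \<inter> W \<noteq> {}" "\<not> W \<subseteq> A" | "A \<inter> W = {}" | "W \<subseteq> A" by blast
    then show ?thesis
    proof cases
      case 1
      then show ?thesis using mid A by blast
    next
      case 2
      show ?thesis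
      \<comment> \<open>A least element can be played even by the empty set. Without one, the empty
        set is a seed and only nonempty \<open>A\<close> remain.\<close>
      proof (cases "\<exists>!x. minimal_in P r x")
        case True
        then obtain z where "z \<in> P" "\<forall>y\<in>P. (z, y) \<in> r"
          using unique_minimal_iff_least[OF po fin] by blast
        moreover from this have "minimal_in P r z" using as by (auto simp: minimal_in_def dest: antisymD)
        ultimately show ?thesis using absorbing_bottom[OF C po fin WU fW cW' mid A 2] by blast
      next
        case False
        obtain z where "minimal_in P r z" using ex_minimal_below[OF po fin xP] by blast
        moreover have "{} \<in> C" using sub False by (auto simp: seed_family_def)
        ultimately show ?thesis using absorbing_bottom[OF C po fin WU fW cW' mid A 2] by blast
      qed
    next
      case 3
      show ?thesis
      proof (cases "\<exists>!x. maximal_in P r x")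
        case True
        then obtain z where "z \<in> P" "\<forall>y\<in>P. (y, z) \<in> r"
          using unique_maximal_iff_greatest[OF po fin] by blast
        moreover from this have "maximal_in P r z" using as by (auto simp: maximal_in_def dest: antisymD)
        ultimately show ?thesis using absorbing_top[OF C po fin WU fW cW' mid A 3] by blast
      next
        case False
        have "U \<in> C" using sub False by (auto simp: seed_family_def)
        then show ?thesis using absorbing_top[OF C po fin WU fW cW' mid A 3 x] by blast
      qed
    qed
  qed
  then show ?thesis using C by (auto simp: absorbing_def)
qed

section \<open>From closed families back to orderings\<close>

text \<open>Take a longest list of legal additions to \<open>F\<close>, which exists because lengths
  are bounded. It cannot be extended, so together with \<open>F\<close> it forms an absorbing
  family, hence everything.\<close>

lemma percolating_if_absorbing:
  assumes F: "F \<subseteq> Pow {1..n}"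
    and full: "\<And>C. absorbing {1..n} P r C \<Longrightarrow> F \<subseteq> C \<Longrightarrow> C = Pow {1..n}"
  shows "percolating n P r F"
proof -
  define ok where "ok As \<longleftrightarrow> distinct As \<and> set As \<subseteq> Pow {1..n} - F \<and>
    (\<forall>i<length As. \<exists>f. induced_copy P r (F \<union> set (take (Suc i) As)) f \<and> As ! i \<in> f ` P)" for As
  have "length As < Suc (card (Pow {1..n}))" if "ok As" for As
  proof -
    have "length As = card (set As)" using that by (simp add: ok_def distinct_card)
    also have "\<dots> \<le> card (Pow {1..n})" using that by (intro card_mono) (auto simp: ok_def)
    finally show ?thesis by simp
  qed
  moreover have "ok []" by (simp add: ok_def)
  ultimately obtain As where As: "ok As" and longest: "\<And>Bs. ok Bs \<Longrightarrow> length Bs \<le> length As"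
    using ex_has_greatest_nat[of ok "[]" length] by blast
  have "absorbing {1..n} P r (F \<union> set As)"
    unfolding absorbing_def
  proof (intro conjI allI impI)
    show "F \<union> set As \<subseteq> Pow {1..n}" using F As by (auto simp: ok_def)
  next
    fix A f
    assume A: "A \<subseteq> {1..n} \<and> induced_copy P r (insert A (F \<union> set As)) f \<and> A \<in> f ` P"
    show "A \<in> F \<union> set As"
    proof (rule ccontr)
      assume new: "A \<notin> F \<union> set As"
      have "\<exists>f. induced_copy P r (F \<union> set (take (Suc i) (As @ [A]))) f \<and> (As @ [A]) ! i \<in> f ` P"
        if "i < length (As @ [A])" for i
      proof (cases "i < length As")
        case True
        then show ?thesis using As by (auto simp: ok_def nth_append)
      next
        case False
        then have "i = length As" using that by simp
        then show ?thesis using A by auto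
      qed
      then have "ok (As @ [A])" using As A new by (auto simp: ok_def)
      then show False using longest by fastforce
    qed
  qed
  then have "F \<union> set As = Pow {1..n}" by (rule full) simp
  then have "set As = Pow {1..n} - F" using As by (auto simp: ok_def)
  then show ?thesis using F As unfolding percolating_def ok_def by blast
qed

section \<open>The lower bound\<close>

text \<open>Forgets when \<open>A\<close> is added and keeps only that some copy uses it; this is
  what forces the empty and the full set into \<open>F\<close>.\<close>

lemma percolating_step:
  assumes "percolating n P r F" "A \<in> Pow {1..n} - F"
  obtains f where "induced_copy P r (Pow {1..n}) f" "A \<in> f ` P"
proof -
  obtain As where As: "set As = Pow {1..n} - F" "F \<subseteq> Pow {1..n}"
    "\<forall>i<length As. \<exists>f. induced_copy P r (F \<union> set (take (Suc i) As)) f \<and> As ! i \<in> f ` P"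
    using assms(1) unfolding percolating_def by blast
  have "A \<in> set As" using assms(2) As(1) by simp
  then obtain i where i: "i < length As" "As ! i = A" by (auto simp: in_set_conv_nth)
  then obtain f where f: "induced_copy P r (F \<union> set (take (Suc i) As)) f" "A \<in> f ` P"
    using As(3) by auto
  have "F \<union> set (take (Suc i) As) \<subseteq> Pow {1..n}" using As(1,2) set_take_subset[of "Suc i" As] by blast
  with f(1) have "induced_copy P r (Pow {1..n}) f" unfolding induced_copy_def by (meson order_trans)
  then show ?thesis using that f(2) by simp
qed

lemma copy_empty_imp_unique_minimal:
  assumes "partial_order_on P r" "finite P" "induced_copy P r Q f" "{} \<in> f ` P"
  shows "\<exists>!x. minimal_in P r x"
proof -
  obtain z where z: "z \<in> P" "f z = {}" using assms(4) by auto
  then have "(z, y) \<in> r" if "y \<in> P" for y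
    using assms(3) that unfolding induced_copy_def by (metis empty_subsetI)
  with z show ?thesis using unique_minimal_iff_least[OF assms(1,2)] by blast
qed

lemma copy_full_imp_unique_maximal:
  assumes "partial_order_on P r" "finite P" "induced_copy P r Q f" "Q \<subseteq> Pow U" "U \<in> f ` P"
  shows "\<exists>!x. maximal_in P r x"
proof -
  obtain z where z: "z \<in> P" "f z = U" using assms(5) by auto
  then have "(y, z) \<in> r" if "y \<in> P" for y
    using assms(3,4) that unfolding induced_copy_def by blast
  with z show ?thesis using unique_maximal_iff_greatest[OF assms(1,2)] by blast
qed

text \<open>\<open>F\<close> contains two disjoint parts: \<open>G\<close>, the rest of the copy
  completed by the first added set, and \<open>E\<close>, the forced extreme sets.\<close>

lemma percolating_card_ge:
  assumes po: "partial_order_on P r" and fin: "finite P" and n: "n \<ge> card P + 1"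
    and perc: "percolating n P r F"
  shows "card F \<ge> card P - 1 + (if \<exists>!x. minimal_in P r x then 0 else 1)
                            + (if \<exists>!x. maximal_in P r x then 0 else 1)"
proof -
  define mn where "mn \<longleftrightarrow> (\<exists>!x. minimal_in P r x)"
  define mx where "mx \<longleftrightarrow> (\<exists>!x. maximal_in P r x)"
  have "card F \<ge> card P - 1 + (if mn then 0 else 1) + (if mx then 0 else 1)"
  \<comment> \<open>If nothing is added there is no first copy; then
    \<open>2 ^ n > n \<ge> card P + 1\<close> suffices.\<close>
  proof (cases "F = Pow {1..n}")
    case True
    then have "card F = 2 ^ n" by (simp add: card_Pow)
    then have "n < card F" using less_exp[of n] by simp
    then show ?thesis using n by (cases mn; cases mx) simp_all
  next
    case False
    let ?U = "{1..n}"
    obtain As where As: "F \<subseteq> Pow ?U" "set As = Pow ?U - F"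
      "\<forall>i<length As. \<exists>f. induced_copy P r (F \<union> set (take (Suc i) As)) f \<and> As ! i \<in> f ` P"
      using perc unfolding percolating_def by blast
    with False have len: "0 < length As" by auto
    then obtain f where f: "induced_copy P r (F \<union> set (take (Suc 0) As)) f" using As(3) by blast
    have "set (take (Suc 0) As) = {As ! 0}" using len by (cases As) auto
    with f have f: "induced_copy P r (insert (As ! 0) F) f" by simp
    have "As ! 0 \<in> Pow ?U" using As(2) len nth_mem[of 0 As] by blast
    then have QU: "insert (As ! 0) F \<subseteq> Pow ?U" using As(1) by blast
    have fF: "finite F" using As(1) by (rule finite_subset) simp
    define G where "G = f ` P - {As ! 0}"
    define E where "E = (if mn then {} else {{}}) \<union> (if mx then {} else {?U})"
    have GF: "G \<subseteq> F" using f by (auto simp: induced_copy_def G_def)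
    have "card (f ` P) = card P" using f by (auto simp: induced_copy_def card_image)
    then have cG: "card G \<ge> card P - 1"
      unfolding G_def by (simp add: card_Diff_singleton_if)
    have "mn" if "{} \<notin> F"
    proof -
      from that have "{} \<in> Pow ?U - F" by simp
      from percolating_step[OF perc this] obtain f where "induced_copy P r (Pow ?U) f" "{} \<in> f ` P" .
      then show ?thesis unfolding mn_def by (rule copy_empty_imp_unique_minimal[OF po fin])
    qed
    moreover have "mx" if "?U \<notin> F"
    proof -
      from that have "?U \<in> Pow ?U - F" by simp
      from percolating_step[OF perc this] obtain f where "induced_copy P r (Pow ?U) f" "?U \<in> f ` P" .
      then show ?thesis
        unfolding mx_def by (intro copy_full_imp_unique_maximal[OF po fin _ order_refl])
    qed
    ultimately have EF: "E \<subseteq> F" unfolding E_def by (cases mn; cases mx) auto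
    \<comment> \<open>Members of \<open>G\<close> lie in a copy of \<open>P\<close>, and a forced
      extreme set lies in none, so \<open>G\<close> and \<open>E\<close> are disjoint.\<close>
    have "mn" if "{} \<in> G"
      using copy_empty_imp_unique_minimal[OF po fin f] that by (simp add: G_def mn_def)
    moreover have "mx" if "?U \<in> G"
      using copy_full_imp_unique_maximal[OF po fin f QU] that by (simp add: G_def mx_def)
    ultimately have "G \<inter> E = {}" unfolding E_def by (cases mn; cases mx) auto
    then have "card (G \<union> E) = card G + card E"
      using GF EF fF by (meson card_Un_disjoint finite_subset)
    moreover have "card (G \<union> E) \<le> card F" using GF EF fF by (simp add: card_mono)
    \<comment> \<open>When both extremes are forced, they must count as two sets.\<close>
    moreover have "{} \<noteq> ?U" using n by auto
    then have "card E = (if mn then 0 else 1) + (if mx then 0 else 1)"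
      unfolding E_def by (cases mn; cases mx) auto
    ultimately show ?thesis using cG by linarith
  qed
  then show ?thesis by (simp only: mn_def mx_def)
qed

section \<open>Size of the seed family and the percolation number\<close>

lemma card_seed_family_le:
  assumes "finite P" "x \<in> P"
  shows "card (seed_family U P r h x) \<le> card P - 1 + (if \<exists>!x. minimal_in P r x then 0 else 1)
                            + (if \<exists>!x. maximal_in P r x then 0 else 1)"
proof -
  let ?I = "(\<lambda>y. h ` {u \<in> P. (u, y) \<in> r}) ` (P - {x})"
  let ?B = "if \<exists>!x. minimal_in P r x then {} else {{}} :: 'b set set"
  let ?T = "if \<exists>!x. maximal_in P r x then {} else {U}"
  have "card ?I \<le> card P - 1"
    using card_image_le[of "P - {x}" "\<lambda>y. h ` {u \<in> P. (u, y) \<in> r}"] assms by simp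
  moreover have "card (?I \<union> ?B \<union> ?T) \<le> card ?I + card ?B + card ?T"
    by (meson add_le_mono1 card_Un_le order_trans)
  ultimately show ?thesis unfolding seed_family_def by (auto split: if_splits)
qed

theorem theorem5p1:
  fixes P :: "'a set" and r :: "'a rel" and p n :: nat
  assumes "partial_order_on P r"
    and "finite P" and "P \<noteq> {}" and "card P = p"
    and "n \<ge> 3 * p - 1"
  shows "sat_p n P r =
    (if (\<nexists>!x. maximal_in P r x) \<and> (\<nexists>!x. minimal_in P r x) then p + 1
     else if (\<exists>!x. maximal_in P r x) \<and> (\<exists>!x. minimal_in P r x) then p - 1
     else p)"
proof -
  \<comment> \<open>One formula for the three cases: each missing least or greatest element costs
    one set beyond \<open>card P - 1\<close>.\<close>
  define k where "k = card P - 1 + (if \<exists>!x. minimal_in P r x then 0 else 1)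
                            + (if \<exists>!x. maximal_in P r x then 0 else 1)"
  \<comment> \<open>Positivity gives \<open>3 * p - 1 \<ge> p + 1\<close> and, with truncated
    subtraction, \<open>p - 1 + 1 = p\<close>.\<close>
  have p: "p > 0" using assms by (auto simp: card_gt_0_iff)
  have n: "n \<ge> card P + 1" "card {1..n} + 1 \<ge> 3 * card P" using assms p by auto
  have lower: "k \<le> card F" if "percolating n P r F" for F
    unfolding k_def by (rule percolating_card_ge[OF assms(1,2) n(1) that])
  obtain x where x: "maximal_in P r x"
    using ex_minimal_below[of P "r\<inverse>"] assms(1-3) by (auto simp: minimal_in_converse)
  then have xP: "x \<in> P" by (simp add: maximal_in_def)
  obtain h where h: "h ` P \<subseteq> {1..n}" "inj_on h P"
    using ex_inj_into[OF assms(2), of "{1..n}"] n by auto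
  let ?F = "seed_family {1..n} P r h x"
  have "percolating n P r ?F"
  proof (rule percolating_if_absorbing)
    show "?F \<subseteq> Pow {1..n}" using h(1) by (auto simp: seed_family_def split: if_splits)
    show "C = Pow {1..n}" if "absorbing {1..n} P r C" "?F \<subseteq> C" for C
      by (rule absorbing_seed_family_eq_Pow[OF that(1) assms(1,2) _ n(2) h x that(2)]) simp
  qed
  \<comment> \<open>Percolation gives \<open>k \<le> card ?F\<close> through the lower bound, so the
    upper estimate on the size is attained.\<close>
  moreover from this have "card ?F = k"
    using lower card_seed_family_le[OF assms(2) xP, of "{1..n}" r h] by (simp add: k_def le_antisym)
  ultimately have "sat_p n P r = k"
    unfolding sat_p_def using lower by (intro Least_equality) auto
  then show ?thesis using p assms(4) by (auto simp: k_def)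
qed

end
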